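(* Let $\mu_1,\dots,\mu_n\in\mathbb{R}$ be constants with $\sum_{i=1}^n\mu_i=0$, let $0<\gamma<2$, and consider respectively SGHMC and EWSG, $$\begin{cases}\theta'_{k+1}=\theta'_k+hr'_k\\ r'_{k+1}=r'_k-h\gamma r'_k-h(\theta'_k-\mu_{I'_k})+\sqrt h\,\sigma\xi'_{k+1}\end{cases}\qquad\text{and}\qquad\begin{cases}\theta_{k+1}=\theta_k+hr_k\\ r_{k+1}=r_k-h\gamma r_k-h(\theta_k-\mu_{I_k})+\sqrt h\,\sigma\xi_{k+1}\end{cases}$$ where $I'_k$ are i.i.d. uniform random variables on $[n]$, $I_k$ are $[\theta,r]$-dependent random variables on $[n]$ satisfying $\mathbb{P}(I_k=i)=1/n+\mathcal{O}(h^p)$, and $\xi_{k+1},\xi'_{k+1}$ are i.i.d. standard Gaussian random variables. Denote $\bar\theta'_k=\mathbb{E}\theta'_k$, $\bar r'_k=\mathbb{E}r'_k$, $\bar\theta_k=\mathbb{E}\theta_k$, $\bar r_k=\mathbb{E}r_k$, $x'_k=[\bar\theta'_k,\bar r'_k]^T$ and $x_k=[\bar\theta_k,\bar r_k]^T$. Then $$x'_k=(I+Ah)^kx'_0,\qquad A=\begin{bmatrix}0&1\\-1&-\gamma\end{bmatrix};$$ for small enough $h$, $\|x'_k\|$ converges to $0$ exponentially as $k\to\infty$; and $x_k$ converges at a comparable speed in the sense that $\|x_k-x'_k\|=\mathcal{O}(h^p)$ if $x_0=x'_0$.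
   Context: All variables $\theta_k,r_k,\theta'_k,r'_k$ are real-valued (dimension one); $h>0$ is the step size, $\sigma$ the noise amplitude, $[n]=\{1,\dots,n\}$, and $I$ in $I+Ah$ is the $2\times2$ identity matrix. The iterations are stochastic gradient Euler–Maruyama discretizations of second-order (underdamped) Langevin dynamics for the potential $V=\sum_{i=1}^nV_i$ with $V_i(\theta)=\frac1n(\theta-\mu_i)^2/2$, so that $n\nabla V_i(\theta)=\theta-\mu_i$. The bounds $\mathcal{O}(h^p)$ (in the hypothesis and in the conclusion) are as $h\to0$, with constants uniform in $k$. *)

theory Defs
  imports "HOL-Probability.Probability" "HOL-Library.Landau_Symbols"
begin

text \<open>
  One chain with step size \<open>h\<close>. The index process \<open>I\<close> may depend in any way on the states,
  the noise and its own past; \<open>\<xi> k\<close> is used only for \<open>k \<ge> 1\<close>. Integrability of the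
  initial state is what makes the means meaningful, as the Bochner integral of a non-integrable
  function is \<open>0\<close>.
\<close>

locale stoch_grad_langevin = prob_space M
  for M :: "'a measure" +
  fixes n :: nat and \<mu> :: "nat \<Rightarrow> real" and \<gamma> \<sigma> h :: real
    and \<theta> r :: "nat \<Rightarrow> 'a \<Rightarrow> real" and I :: "nat \<Rightarrow> 'a \<Rightarrow> nat" and \<xi> :: "nat \<Rightarrow> 'a \<Rightarrow> real"
  assumes integrable_\<theta>_0: "integrable M (\<theta> 0)"
    and integrable_r_0: "integrable M (r 0)"
    and index_rv: "\<And>k. random_variable (count_space {1..n}) (I k)"
    and noise_indep: "indep_vars (\<lambda>_. borel) \<xi> {1..}"
    and noise_normal: "\<And>k. distributed M lborel (\<xi> (Suc k)) std_normal_density"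
    and \<theta>_Suc: "\<And>k \<omega>. \<omega> \<in> space M \<Longrightarrow> \<theta> (Suc k) \<omega> = \<theta> k \<omega> + h * r k \<omega>"
    and r_Suc: "\<And>k \<omega>. \<omega> \<in> space M \<Longrightarrow>
      r (Suc k) \<omega> = r k \<omega> - h * \<gamma> * r k \<omega> - h * (\<theta> k \<omega> - \<mu> (I k \<omega>)) + sqrt h * \<sigma> * \<xi> (Suc k) \<omega>"

locale sghmc = stoch_grad_langevin +
  assumes index_indep: "indep_vars (\<lambda>_. count_space {1..n}) I UNIV"
    and index_uniform: "\<And>k. distr M (count_space {1..n}) (I k) = uniform_count_measure {1..n}"

text \<open>
  The condition \<open>\<P>(I\<^sub>k = i) = 1/n + O(h\<^sup>p)\<close> constrains a family of chains, one for each step size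
  (all other arguments below are indexed by \<open>h\<close>). Since \<open>top\<close> is the principal filter of the whole
  type, an event holds eventually in \<open>at_right 0 \<times>\<^sub>F top\<close> iff, for all sufficiently small
  \<open>h > 0\<close>, it holds for \<^emph>\<open>every\<close> \<open>k\<close>; so the bounds as \<open>h \<rightarrow> 0\<close> are uniform in \<open>k\<close>.
\<close>

definition ewsg_family ::
  "(real \<Rightarrow> 'a measure) \<Rightarrow> nat \<Rightarrow> (nat \<Rightarrow> real) \<Rightarrow> real \<Rightarrow> real \<Rightarrow> real \<Rightarrow>
   (real \<Rightarrow> nat \<Rightarrow> 'a \<Rightarrow> real) \<Rightarrow> (real \<Rightarrow> nat \<Rightarrow> 'a \<Rightarrow> real) \<Rightarrow> (real \<Rightarrow> nat \<Rightarrow> 'a \<Rightarrow> nat) \<Rightarrow>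
   (real \<Rightarrow> nat \<Rightarrow> 'a \<Rightarrow> real) \<Rightarrow> bool" where
  "ewsg_family M n \<mu> \<gamma> \<sigma> p \<theta> r I \<xi> \<longleftrightarrow>
     (\<forall>h>0. stoch_grad_langevin (M h) n \<mu> \<gamma> \<sigma> h (\<theta> h) (r h) (I h) (\<xi> h)) \<and>
     (\<forall>i\<in>{1..n}. (\<lambda>(h, k). measure (M h) {\<omega> \<in> space (M h). I h k \<omega> = i} - 1 / real n)
        \<in> O[at_right 0 \<times>\<^sub>F top](\<lambda>(h, k). h powr p))"

definition mean_state :: "'a measure \<Rightarrow> ('a \<Rightarrow> real) \<Rightarrow> ('a \<Rightarrow> real) \<Rightarrow> real ^ 2" where
  "mean_state M \<theta> r = vector [\<integral>\<omega>. \<theta> \<omega> \<partial>M, \<integral>\<omega>. r \<omega> \<partial>M]"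

definition langevin_matrix :: "real \<Rightarrow> real ^ 2 ^ 2" where
  "langevin_matrix \<gamma> = vector [vector [0, 1], vector [- 1, - \<gamma>]]"

primrec matrix_power :: "real ^ 'n ^ 'n \<Rightarrow> nat \<Rightarrow> real ^ 'n ^ 'n" where
  "matrix_power B 0 = mat 1"
| "matrix_power B (Suc k) = B ** matrix_power B k"

text \<open>The rate \<open>c\<close> is per iteration and may depend on the sequence.\<close>

definition exponentially_to_0 :: "(nat \<Rightarrow> 'b::real_normed_vector) \<Rightarrow> bool" where
  "exponentially_to_0 x \<longleftrightarrow> (\<exists>C. \<exists>c>0. \<forall>k. norm (x k) \<le> C * exp (- c * real k))"

end

theory Submission
  imports Defs
begin

text \<open>
  For \<open>0 < \<gamma> < 2\<close> the matrix \<open>A\<close> has the complex eigenvalue \<open>\<lambda> = - \<gamma>/2 + i s\<close> with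
  \<open>s = sqrt (1 - \<gamma>\<^sup>2/4)\<close>, which has modulus 1. The left eigenvector of \<open>\<lambda>\<close> gives a complex coordinate
  \<open>z = r - cnj \<lambda> * \<theta>\<close> on the real plane, in which \<open>A\<close> is multiplication by \<open>\<lambda>\<close>. The
  means therefore satisfy a scalar recursion \<open>z (k + 1) = (1 + h \<lambda>) z k + h b k\<close>, where
  \<open>b k\<close> is the mean of \<open>\<mu> (I k)\<close>: it vanishes for uniform indices and is
  \<open>O(h\<^sup>p)\<close> for EWSG. Since \<open>\<bar>1 + h \<lambda>\<bar>\<^sup>2 = 1 - \<gamma> h + h\<^sup>2\<close>, one step contracts by at least
  \<open>1 - \<gamma> h / 4\<close> for small \<open>h\<close>, and the geometric series of the errors \<open>h b k\<close> sums to
  \<open>O(h\<^sup>p)\<close> uniformly in \<open>k\<close>.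
\<close>

section \<open>Means of a single chain\<close>

context stoch_grad_langevin
begin

lemma integrable_noise: "integrable M (\<xi> (Suc k))"
  and expectation_noise: "expectation (\<xi> (Suc k)) = 0"
  using distributed_integrable[OF noise_normal, of "\<lambda>x. x" k] integrable_std_normal_moment[of 1]
    standard_normal_distributed_expectation[OF noise_normal[of k]]
  by simp_all

lemma index_range: "\<omega> \<in> space M \<Longrightarrow> I k \<omega> \<in> {1..n}"
  using measurable_space[OF index_rv] by simp

lemma integrable_drift: "integrable M (\<lambda>\<omega>. \<mu> (I k \<omega>))"
proof (rule integrable_const_bound)
  show "AE \<omega> in M. norm (\<mu> (I k \<omega>)) \<le> (\<Sum>i=1..n. \<bar>\<mu> i\<bar>)"
    using index_range by (intro AE_I2) (auto intro!: member_le_sum)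
  show "(\<lambda>\<omega>. \<mu> (I k \<omega>)) \<in> borel_measurable M"
    by (rule measurable_compose[OF index_rv]) simp
qed

text \<open>\<open>\<mu> (I k \<omega>)\<close> is a finite combination of indicators, so its mean
  is determined by the law of \<open>I k\<close>, however the index depends on the state.\<close>

lemma expectation_drift:
  "expectation (\<lambda>\<omega>. \<mu> (I k \<omega>)) = (\<Sum>i=1..n. \<mu> i * prob {\<omega>\<in>space M. I k \<omega> = i})"
proof -
  have sets: "{\<omega>\<in>space M. I k \<omega> = i} \<in> sets M" if "i \<in> {1..n}" for i
    using measurable_sets[OF index_rv, of "{i}" k] that
    by (simp add: vimage_def Int_def conj_commute)
  have "expectation (\<lambda>\<omega>. \<mu> (I k \<omega>))
      = expectation (\<lambda>\<omega>. \<Sum>i=1..n. \<mu> i * indicator {\<omega>\<in>space M. I k \<omega> = i} \<omega>)"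
  proof (rule Bochner_Integration.integral_cong)
    fix \<omega> assume \<omega>: "\<omega> \<in> space M"
    have "(\<Sum>i=1..n. \<mu> i * indicator {\<omega>\<in>space M. I k \<omega> = i} \<omega>)
        = (\<Sum>i=1..n. if i = I k \<omega> then \<mu> i else 0)"
      using \<omega> by (intro sum.cong) auto
    also have "\<dots> = \<mu> (I k \<omega>)"
      using index_range[OF \<omega>] by simp
    finally show "\<mu> (I k \<omega>) = (\<Sum>i=1..n. \<mu> i * indicator {\<omega>\<in>space M. I k \<omega> = i} \<omega>)" ..
  qed simp
  also have "\<dots> = (\<Sum>i=1..n. \<mu> i * prob {\<omega>\<in>space M. I k \<omega> = i})"
    using sets by (subst Bochner_Integration.integral_sum) (auto simp: less_top[symmetric])
  finally show ?thesis .
qed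

lemma integrable_state: "integrable M (\<theta> k) \<and> integrable M (r k)"
proof (induction k)
  case 0
  show ?case using integrable_\<theta>_0 integrable_r_0 by simp
next
  case (Suc k)
  then have "integrable M (\<lambda>\<omega>. \<theta> k \<omega> + h * r k \<omega>)"
    and "integrable M (\<lambda>\<omega>. r k \<omega> - h * \<gamma> * r k \<omega> - h * (\<theta> k \<omega> - \<mu> (I k \<omega>))
      + sqrt h * \<sigma> * \<xi> (Suc k) \<omega>)"
    using integrable_noise[of k] integrable_drift[of k] by auto
  then show ?case
    by (simp add: \<theta>_Suc r_Suc cong: Bochner_Integration.integrable_cong)
qed

lemma expectation_\<theta>_Suc: "expectation (\<theta> (Suc k)) = expectation (\<theta> k) + h * expectation (r k)"
proof -
  have "expectation (\<theta> (Suc k)) = expectation (\<lambda>\<omega>. \<theta> k \<omega> + h * r k \<omega>)"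
    by (rule Bochner_Integration.integral_cong) (simp_all add: \<theta>_Suc)
  then show ?thesis
    using integrable_state[of k] by simp
qed

lemma expectation_r_Suc:
  "expectation (r (Suc k)) = expectation (r k) - h * \<gamma> * expectation (r k)
     - h * (expectation (\<theta> k) - expectation (\<lambda>\<omega>. \<mu> (I k \<omega>)))"
proof -
  have "expectation (r (Suc k)) = expectation (\<lambda>\<omega>. r k \<omega> - h * \<gamma> * r k \<omega>
      - h * (\<theta> k \<omega> - \<mu> (I k \<omega>)) + sqrt h * \<sigma> * \<xi> (Suc k) \<omega>)"
    by (rule Bochner_Integration.integral_cong) (simp_all add: r_Suc)
  then show ?thesis
    using integrable_state[of k] integrable_noise[of k] integrable_drift[of k]
    by (simp add: expectation_noise)
qed

text \<open>The gradient is affine in \<open>\<theta>\<close> and the noise is centered, so the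
  recursion for the means closes; the random index survives only as an inhomogeneous term.\<close>

lemma mean_state_Suc:
  "mean_state M (\<theta> (Suc k)) (r (Suc k))
     = (mat 1 + h *\<^sub>R langevin_matrix \<gamma>) *v mean_state M (\<theta> k) (r k)
       + h *\<^sub>R vector [0, expectation (\<lambda>\<omega>. \<mu> (I k \<omega>))]"
  by (simp add: vec_eq_iff forall_2 mean_state_def langevin_matrix_def matrix_vector_mult_def
      sum_2 mat_def expectation_\<theta>_Suc expectation_r_Suc algebra_simps)

text \<open>Since the \<open>\<mu> i\<close> sum to 0, subtracting \<open>1 / real n\<close> from
  every probability changes nothing. The deviations that appear are 0 for SGHMC and are what the
  EWSG hypothesis bounds.\<close>

lemma expectation_drift_centered:
  assumes "(\<Sum>i=1..n. \<mu> i) = 0"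
  shows "expectation (\<lambda>\<omega>. \<mu> (I k \<omega>))
    = (\<Sum>i=1..n. \<mu> i * (prob {\<omega>\<in>space M. I k \<omega> = i} - 1 / real n))"
  using assms
  by (simp add: expectation_drift right_diff_distrib sum_subtractf flip: sum_divide_distrib)

end

lemma (in sghmc) prob_index:
  assumes "i \<in> {1..n}"
  shows "prob {\<omega>\<in>space M. I k \<omega> = i} = 1 / real n"
proof -
  have "prob {\<omega>\<in>space M. I k \<omega> = i} = prob (I k -` {i} \<inter> space M)"
    by (intro arg_cong[where f = prob]) auto
  also have "\<dots> = measure (uniform_count_measure {1..n}) {i}"
    using measure_distr[OF index_rv, of "{i}" k] assms unfolding index_uniform by simp
  also have "\<dots> = 1 / real n"
    using assms by (simp add: measure_uniform_count_measure)
  finally show ?thesis .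
qed

section \<open>The complex eigen-coordinate\<close>

definition langevin_eigenvalue :: "real \<Rightarrow> complex" where
  "langevin_eigenvalue \<gamma> = Complex (- \<gamma> / 2) (sqrt (1 - \<gamma>\<^sup>2 / 4))"

definition eigen_coord :: "real \<Rightarrow> real ^ 2 \<Rightarrow> complex" where
  "eigen_coord \<gamma> v = of_real (v $ 2) - cnj (langevin_eigenvalue \<gamma>) * of_real (v $ 1)"

lemma eigen_coord_diff: "eigen_coord \<gamma> (v - w) = eigen_coord \<gamma> v - eigen_coord \<gamma> w"
  by (simp add: eigen_coord_def algebra_simps)

lemma eigen_coord_0 [simp]: "eigen_coord \<gamma> 0 = 0"
  by (simp add: eigen_coord_def)

text \<open>The row vector \<open>(- cnj \<lambda>, 1)\<close> is a left eigenvector of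
  \<open>langevin_matrix \<gamma>\<close> because
  \<open>\<lambda> + cnj \<lambda> = - \<gamma>\<close> and
  \<open>\<lambda> * cnj \<lambda> = 1\<close>. Its second entry 1 passes \<open>b\<close> on
  unchanged.\<close>

lemma eigen_coord_step:
  assumes "\<bar>\<gamma>\<bar> \<le> 2"
  shows "eigen_coord \<gamma> ((mat 1 + h *\<^sub>R langevin_matrix \<gamma>) *v v + h *\<^sub>R vector [0, b])
    = (1 + of_real h * langevin_eigenvalue \<gamma>) * eigen_coord \<gamma> v + of_real (h * b)"
proof -
  have "\<gamma>\<^sup>2 \<le> 2\<^sup>2"
    using assms by (metis abs_ge_zero power2_abs power_mono)
  \<comment> \<open>Simplification turns the squared imaginary part of the eigenvalue into this
    absolute value.\<close>
  then have "\<bar>1 - \<gamma> * \<gamma> / 4\<bar> = 1 - \<gamma> * \<gamma> / 4"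
    by (simp add: power2_eq_square)
  then show ?thesis
    by (simp add: complex_eq_iff eigen_coord_def langevin_eigenvalue_def langevin_matrix_def
        matrix_vector_mult_def sum_2 mat_def algebra_simps power2_eq_square)
qed

text \<open>As the eigenvalue is not real, the coordinate is injective on the real plane: its
  imaginary part recovers \<open>v $ 1\<close> up to the factor \<open>s\<close>, and its real part
  then gives \<open>v $ 2\<close>.\<close>

lemma norm_le_eigen_coord:
  assumes "0 < \<gamma>" "\<gamma> < 2"
  shows "norm v \<le> (1 + 2 / sqrt (1 - \<gamma>\<^sup>2 / 4)) * norm (eigen_coord \<gamma> v)"
proof -
  define s where "s = sqrt (1 - \<gamma>\<^sup>2 / 4)"
  define z where "z = eigen_coord \<gamma> v"
  have "\<gamma>\<^sup>2 < 2\<^sup>2"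
    using assms by (intro power_strict_mono) auto
  then have s: "s > 0" "s\<^sup>2 = 1 - \<gamma>\<^sup>2 / 4" by (auto simp: s_def)
  have "Im z = s * v $ 1"
    by (simp add: z_def s_def eigen_coord_def langevin_eigenvalue_def)
  then have 1: "\<bar>v $ 1\<bar> \<le> norm z / s"
    using abs_Im_le_cmod[of z] s by (simp add: field_simps abs_mult)
  have "Re z = v $ 2 + \<gamma> / 2 * v $ 1"
    by (simp add: z_def eigen_coord_def langevin_eigenvalue_def)
  then have "\<bar>v $ 2\<bar> \<le> \<bar>Re z\<bar> + \<gamma> / 2 * \<bar>v $ 1\<bar>"
    using abs_triangle_ineq4[of "Re z" "\<gamma> / 2 * v $ 1"] assms by (simp add: abs_mult)
  also have "\<dots> \<le> norm z + 1 * \<bar>v $ 1\<bar>"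
    using assms by (intro add_mono mult_right_mono abs_Re_le_cmod) auto
  finally have 2: "\<bar>v $ 2\<bar> \<le> norm z + \<bar>v $ 1\<bar>" by simp
  have "norm v \<le> \<bar>v $ 1\<bar> + \<bar>v $ 2\<bar>"
    using norm_le_l1_cart[of v] by (simp add: sum_2)
  also have "\<dots> \<le> norm z + 2 * (norm z / s)"
    using 1 2 by linarith
  finally show ?thesis
    by (simp add: z_def s_def algebra_simps)
qed

text \<open>The squared modulus is \<open>1 - \<gamma> * h + h * h\<close>. For
  \<open>h \<le> \<gamma> / 2\<close> the quadratic term costs at most half of the linear one, and
  adding a square completes \<open>(1 - \<gamma> / 4 * h)\<^sup>2\<close>.\<close>

lemma norm_step_factor_le:
  assumes "0 < \<gamma>" "\<gamma> < 2" "0 < h" "h \<le> \<gamma> / 2"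
  shows "norm (1 + of_real h * langevin_eigenvalue \<gamma>) \<le> 1 - \<gamma> / 4 * h"
proof -
  have \<gamma>2: "\<gamma>\<^sup>2 \<le> 2\<^sup>2"
    using assms by (intro power_mono) auto
  have "\<gamma> / 4 * h \<le> 1 / 2 * 1"
    using assms by (intro mult_mono) auto
  then have pos: "0 \<le> 1 - \<gamma> / 4 * h"
    by simp
  have "(norm (1 + of_real h * langevin_eigenvalue \<gamma>))\<^sup>2 = 1 - \<gamma> * h + h * h"
    using \<gamma>2 by (simp add: cmod_power2 langevin_eigenvalue_def power_mult_distrib)
      (simp add: power2_eq_square field_simps)
  also have "\<dots> \<le> 1 - \<gamma> * h + h * (\<gamma> / 2)"
    using assms by (intro add_left_mono mult_left_mono) auto
  also have "\<dots> \<le> 1 - \<gamma> / 2 * h + (\<gamma> / 4 * h)\<^sup>2"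
    by (simp add: field_simps)
  also have "\<dots> = (1 - \<gamma> / 4 * h)\<^sup>2"
    by (simp add: power2_eq_square field_simps)
  finally show ?thesis
    using pos by (rule power2_le_imp_le)
qed

text \<open>\<open>B\<close> is a fixed point of the monotone map
  \<open>t \<mapsto> q * t + (1 - q) * B\<close>, so the bound is invariant. This stands in for
  summing a geometric series.\<close>

lemma affine_recursion_le:
  fixes u :: "nat \<Rightarrow> real"
  assumes "u 0 \<le> B" and "\<And>k. u (Suc k) \<le> q * u k + (1 - q) * B" and "0 \<le> q"
  shows "u k \<le> B"
proof (induction k)
  case (Suc k)
  have "u (Suc k) \<le> q * u k + (1 - q) * B"
    by fact
  also have "\<dots> \<le> q * B + (1 - q) * B"
    using Suc \<open>0 \<le> q\<close> by (intro add_right_mono mult_left_mono)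
  finally show ?case
    by (simp add: algebra_simps)
qed fact

lemma eventually_prod_top:
  "(\<forall>\<^sub>F (a, b) in F \<times>\<^sub>F top. P a b) \<longleftrightarrow> (\<forall>\<^sub>F a in F. \<forall>b. P a b)"
  by (auto simp: eventually_prod_filter eventually_top elim: eventually_mono)

section \<open>Decay of the SGHMC means and comparison with EWSG\<close>

theorem theorem5:
  fixes n :: nat and \<mu> :: "nat \<Rightarrow> real" and \<gamma> \<sigma> p :: real
    and M' :: "real \<Rightarrow> 'a measure" and \<theta>' r' :: "real \<Rightarrow> nat \<Rightarrow> 'a \<Rightarrow> real"
    and I' :: "real \<Rightarrow> nat \<Rightarrow> 'a \<Rightarrow> nat" and \<xi>' :: "real \<Rightarrow> nat \<Rightarrow> 'a \<Rightarrow> real"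
    and M :: "real \<Rightarrow> 'b measure" and \<theta> r :: "real \<Rightarrow> nat \<Rightarrow> 'b \<Rightarrow> real"
    and I :: "real \<Rightarrow> nat \<Rightarrow> 'b \<Rightarrow> nat" and \<xi> :: "real \<Rightarrow> nat \<Rightarrow> 'b \<Rightarrow> real"
    and x' x :: "real \<Rightarrow> nat \<Rightarrow> real ^ 2"
  assumes n_pos: "0 < n"
    and sum_\<mu>: "(\<Sum>i=1..n. \<mu> i) = 0"
    and \<gamma>: "0 < \<gamma>" "\<gamma> < 2"
    and sghmc: "\<And>h. 0 < h \<Longrightarrow> sghmc (M' h) n \<mu> \<gamma> \<sigma> h (\<theta>' h) (r' h) (I' h) (\<xi>' h)"
    and ewsg: "ewsg_family M n \<mu> \<gamma> \<sigma> p \<theta> r I \<xi>"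
  defines "x' \<equiv> (\<lambda>h k. mean_state (M' h) (\<theta>' h k) (r' h k))"
    and "x \<equiv> (\<lambda>h k. mean_state (M h) (\<theta> h k) (r h k))"
  shows "(\<forall>h>0. \<forall>k. x' h k = matrix_power (mat 1 + h *\<^sub>R langevin_matrix \<gamma>) k *v x' h 0) \<and>
    (\<forall>\<^sub>F h in at_right 0. exponentially_to_0 (x' h)) \<and>
    ((\<forall>h>0. x h 0 = x' h 0) \<longrightarrow>
      (\<lambda>(h, k). norm (x h k - x' h k)) \<in> O[at_right 0 \<times>\<^sub>F top](\<lambda>(h, k). h powr p))"
proof -
  define K where "K = 1 + 2 / sqrt (1 - \<gamma>\<^sup>2 / 4)"
  define q where "q = (\<lambda>h. 1 + of_real h * langevin_eigenvalue \<gamma>)"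
  define z where "z = (\<lambda>v. eigen_coord \<gamma> v)"
  define b where "b = (\<lambda>h k. \<Sum>i=1..n. \<mu> i * (measure (M h) {\<omega> \<in> space (M h). I h k \<omega> = i} - 1 / real n))"
  have norm_le: "norm v \<le> K * norm (z v)" for v
    unfolding K_def z_def by (rule norm_le_eigen_coord[OF \<gamma>])
  have "0 \<le> 1 - \<gamma>\<^sup>2 / 4"
    using power_mono[of \<gamma> 2 2] \<gamma> by simp
  then have K: "0 \<le> K"
    by (simp add: K_def)
  have q_le: "norm (q h) \<le> 1 - \<gamma> / 4 * h" if "0 < h" "h \<le> \<gamma> / 2" for h
    unfolding q_def using that \<gamma> by (intro norm_step_factor_le)
  have small: "\<forall>\<^sub>F h in at_right 0. 0 < h \<and> h \<le> \<gamma> / 2"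
    using eventually_at_right_real[of 0 "\<gamma> / 2"] \<gamma> by (auto elim!: eventually_mono)

  have vec_0: "vector [0, 0] = (0 :: real ^ 2)"
    by (simp add: vec_eq_iff forall_2)
  have x'_Suc: "x' h (Suc k) = (mat 1 + h *\<^sub>R langevin_matrix \<gamma>) *v x' h k" if "0 < h" for h k
  proof -
    interpret sghmc "M' h" n \<mu> \<gamma> \<sigma> h "\<theta>' h" "r' h" "I' h" "\<xi>' h"
      using that by (rule sghmc)
    \<comment> \<open>Uniform indices make every deviation vanish, so the mean drift is 0.\<close>
    show ?thesis
      unfolding x'_def mean_state_Suc by (simp add: expectation_drift_centered[OF sum_\<mu>] prob_index vec_0)
  qed
  have zx'_Suc: "z (x' h (Suc k)) = q h * z (x' h k)" if "0 < h" for h k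
    using eigen_coord_step[of \<gamma> h "x' h k" 0] x'_Suc[OF that, of k] \<gamma>
    by (simp add: z_def q_def vec_0)
  have zx_Suc: "z (x h (Suc k)) = q h * z (x h k) + of_real (h * b h k)" if "0 < h" for h k
  proof -
    interpret stoch_grad_langevin "M h" n \<mu> \<gamma> \<sigma> h "\<theta> h" "r h" "I h" "\<xi> h"
      using ewsg that by (simp add: ewsg_family_def)
    show ?thesis
      using \<gamma> unfolding x_def mean_state_Suc z_def q_def b_def
      by (subst eigen_coord_step) (simp_all add: expectation_drift_centered[OF sum_\<mu>])
  qed

  have "x' h k = matrix_power (mat 1 + h *\<^sub>R langevin_matrix \<gamma>) k *v x' h 0" if "0 < h" for h k
    by (induction k) (simp_all add: x'_Suc[OF that] matrix_vector_mul_assoc)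
  moreover have "exponentially_to_0 (x' h)" if h: "0 < h" "h \<le> \<gamma> / 2" for h
    unfolding exponentially_to_0_def
  proof (intro exI conjI allI)
    \<comment> \<open>This rate per iteration comes from \<open>1 - t \<le> exp (- t)\<close> with
      \<open>t = \<gamma> / 4 * h\<close>.\<close>
    show "0 < \<gamma> / 4 * h"
      using \<gamma> h by simp
    fix k
    have "z (x' h k) = q h ^ k * z (x' h 0)"
      by (induction k) (simp_all add: zx'_Suc[OF h(1)])
    then have "norm (z (x' h k)) = norm (q h) ^ k * norm (z (x' h 0))"
      by (simp add: norm_mult norm_power)
    also have "\<dots> \<le> exp (- (\<gamma> / 4 * h)) ^ k * norm (z (x' h 0))"
      using q_le[OF h] exp_ge_add_one_self[of "- (\<gamma> / 4 * h)"]
      by (intro mult_right_mono power_mono) auto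
    also have "exp (- (\<gamma> / 4 * h)) ^ k = exp (- (\<gamma> / 4 * h) * real k)"
      by (simp add: mult_ac flip: exp_of_nat_mult)
    finally have "K * norm (z (x' h k)) \<le> K * (exp (- (\<gamma> / 4 * h) * real k) * norm (z (x' h 0)))"
      by (rule mult_left_mono[OF _ K])
    then have "K * norm (z (x' h k)) \<le> K * norm (z (x' h 0)) * exp (- (\<gamma> / 4 * h) * real k)"
      by (simp only: mult_ac)
    then show "norm (x' h k) \<le> K * norm (z (x' h 0)) * exp (- (\<gamma> / 4 * h) * real k)"
      using norm_le order_trans by blast
  qed
  then have "\<forall>\<^sub>F h in at_right 0. exponentially_to_0 (x' h)"
    using small by (auto elim: eventually_mono)
  moreover have "(\<lambda>(h, k). norm (x h k - x' h k)) \<in> O[at_right 0 \<times>\<^sub>F top](\<lambda>(h, k). h powr p)"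
    if start: "\<forall>h>0. x h 0 = x' h 0"
  proof -
    have "(\<lambda>(h, k). b h k) \<in> O[at_right 0 \<times>\<^sub>F top](\<lambda>(h, k). h powr p)"
      using ewsg unfolding b_def ewsg_family_def case_prod_unfold
      by (intro big_sum_in_bigo) auto
    then obtain C where "0 < C"
      and "\<forall>\<^sub>F (h, k) in at_right 0 \<times>\<^sub>F top. \<bar>b h k\<bar> \<le> C * h powr p"
      by (elim landau_o.bigE) (auto simp: case_prod_unfold)
    then have "\<forall>\<^sub>F h in at_right 0. \<forall>k. \<bar>b h k\<bar> \<le> C * h powr p"
      by (simp add: eventually_prod_top)
    \<comment> \<open>\<open>C\<close> is fixed before \<open>h\<close> and \<open>k\<close>, so the
      resulting constant is uniform in both.\<close>
    with small have "\<forall>\<^sub>F h in at_right 0. \<forall>k. norm (x h k - x' h k) \<le> K * (4 * C / \<gamma>) * h powr p"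
    proof eventually_elim
      case (elim h)
      \<comment> \<open>The fixed point of
        \<open>t \<mapsto> (1 - \<gamma> / 4 * h) * t + h * (C * h powr p)\<close>. The factor
        \<open>h\<close> of each error cancels against the contraction gap
        \<open>\<gamma> / 4 * h\<close>, so no power of \<open>h\<close> is lost.\<close>
      define B where "B = 4 * C / \<gamma> * h powr p"
      have h: "0 < h" "h \<le> \<gamma> / 2" and b_le: "\<And>k. \<bar>b h k\<bar> \<le> C * h powr p"
        using elim by auto
      define e where "e = (\<lambda>k. z (x h k - x' h k))"
      \<comment> \<open>Both chains share the factor \<open>q h\<close>, so their difference is
        driven by the EWSG drift alone; it starts at 0.\<close>
      have e_Suc: "e (Suc k) = q h * e k + of_real (h * b h k)" for k
        using zx_Suc[OF h(1), of k] zx'_Suc[OF h(1), of k]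
        by (simp add: e_def z_def eigen_coord_diff algebra_simps)
      have "norm (e k) \<le> B" for k
      proof (rule affine_recursion_le)
        show "norm (e 0) \<le> B"
          using start h \<open>0 < C\<close> \<gamma> by (simp add: e_def z_def B_def)
        show "0 \<le> 1 - \<gamma> / 4 * h"
          using q_le[OF h] norm_ge_zero order_trans by blast
        fix k
        have "norm (e (Suc k)) \<le> norm (q h) * norm (e k) + h * \<bar>b h k\<bar>"
          unfolding e_Suc using norm_triangle_ineq[of "q h * e k" "of_real (h * b h k)"] h
          by (simp add: norm_mult)
        also have "\<dots> \<le> (1 - \<gamma> / 4 * h) * norm (e k) + h * (C * h powr p)"
          using q_le[OF h] b_le h by (intro add_mono mult_right_mono mult_left_mono) auto
        also have "h * (C * h powr p) = (1 - (1 - \<gamma> / 4 * h)) * B"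
          using \<gamma> by (simp add: B_def)
        finally show "norm (e (Suc k)) \<le> (1 - \<gamma> / 4 * h) * norm (e k) + (1 - (1 - \<gamma> / 4 * h)) * B" .
      qed
      then have "norm (x h k - x' h k) \<le> K * B" for k
        using norm_le[of "x h k - x' h k"] mult_left_mono[OF _ K] order_trans unfolding e_def by blast
      then show ?case
        by (simp add: B_def mult_ac)
    qed
    then have "\<forall>\<^sub>F (h, k) in at_right 0 \<times>\<^sub>F top. norm (x h k - x' h k) \<le> K * (4 * C / \<gamma>) * h powr p"
      by (simp add: eventually_prod_top)
    then show ?thesis
      by (intro bigoI[where c = "K * (4 * C / \<gamma>)"]) (auto simp: case_prod_unfold)
  qed
  ultimately show ?thesis
    by blast
qed

end
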